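(* For all integers $k\ge 3$, $$z_k\ \ge\ \frac{1}{\left\lceil \sqrt{k+1/4}-1/2\right\rceil}.$$
   Context: Given an edge-coloring $c$ (an arbitrary assignment of colors to edges) of the complete graph $K_n$, let $z(n,c,s)$ be the fraction of the $n$ vertices that are incident with at least one edge of color $s$, and let $z(n,c)$ be the maximum of $z(n,c,s)$ over all colors $s$ appearing in $c$. Let $z_k(n)$ be the minimum of $z(n,c)$ over all edge-colorings $c$ of $K_n$ that use at most $k$ colors, and let $z_k=\inf_{n\ge 2} z_k(n)$. *)

theory Defs
  imports Complex_Main
begin

text \<open>
  The complete graph \<open>K\<^sub>n\<close> has vertex set \<open>{..<n}\<close>; its edges are the two-element sets of
  vertices.  An edge-coloring is a function on sets of vertices, of which only the values on
  edges matter.  Natural numbers serve as colors; since colorings use finitely many colors, this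
  is no restriction.
\<close>

definition K_edges :: "nat \<Rightarrow> nat set set" where
  "K_edges n = {e. e \<subseteq> {..<n} \<and> card e = 2}"

definition colors_used :: "nat \<Rightarrow> (nat set \<Rightarrow> nat) \<Rightarrow> nat set" where
  "colors_used n c = c ` K_edges n"

definition z_color :: "nat \<Rightarrow> (nat set \<Rightarrow> nat) \<Rightarrow> nat \<Rightarrow> real" where
  "z_color n c s = real (card {v \<in> {..<n}. \<exists>e \<in> K_edges n. v \<in> e \<and> c e = s}) / real n"

definition z_coloring :: "nat \<Rightarrow> (nat set \<Rightarrow> nat) \<Rightarrow> real" where
  "z_coloring n c = Max (z_color n c ` colors_used n c)"

definition z_order :: "nat \<Rightarrow> nat \<Rightarrow> real" where
  "z_order k n = Min {z_coloring n c | c. card (colors_used n c) \<le> k}"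

definition z_inf :: "nat \<Rightarrow> real" where
  "z_inf k = (INF n \<in> {2..}. z_order k n)"

text \<open>The maximum, the minimum and the infimum above are taken over admissible sets:\<close>

lemma finite_K_edges: "finite (K_edges n)"
  by (rule finite_subset[of _ "Pow {..<n}"]) (auto simp: K_edges_def)

lemma finite_colors_used: "finite (colors_used n c)"
  by (simp add: colors_used_def finite_K_edges)

lemma colors_used_nonempty:
  assumes "n \<ge> 2"
  shows "colors_used n c \<noteq> {}"
proof -
  have "{0, 1} \<in> K_edges n" using assms by (auto simp: K_edges_def)
  then show ?thesis by (auto simp: colors_used_def)
qed

lemma z_coloring_in:
  assumes "n \<ge> 2"
  shows "z_coloring n c \<in> (\<lambda>i. real i / real n) ` {..n}"
proof -
  have "z_coloring n c \<in> z_color n c ` colors_used n c"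
    unfolding z_coloring_def
    by (rule Max_in) (simp_all add: finite_colors_used colors_used_nonempty assms)
  then obtain s where s: "z_coloring n c = z_color n c s" by auto
  have "card {v \<in> {..<n}. \<exists>e \<in> K_edges n. v \<in> e \<and> c e = s} \<le> card {..<n}"
    by (rule card_mono) auto
  then show ?thesis unfolding s z_color_def by auto
qed

lemma finite_z_colorings:
  assumes "n \<ge> 2"
  shows "finite {z_coloring n c | c. card (colors_used n c) \<le> k}"
  by (rule finite_subset[of _ "(\<lambda>i. real i / real n) ` {..n}"]) (use z_coloring_in[OF assms] in auto)

lemma z_colorings_nonempty:
  assumes "n \<ge> 2" "k \<ge> 1"
  shows "{z_coloring n c | c. card (colors_used n c) \<le> k} \<noteq> {}"
proof -
  have "colors_used n (\<lambda>_. 0) \<subseteq> {0}" by (auto simp: colors_used_def)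
  then have "card (colors_used n (\<lambda>_. 0)) \<le> card {0::nat}" by (intro card_mono) auto
  then have "card (colors_used n (\<lambda>_. 0)) \<le> k" using assms(2) by simp
  then show ?thesis by blast
qed

lemma bdd_below_z_order:
  assumes "k \<ge> 1"
  shows "bdd_below (z_order k ` {2..})"
proof (rule bdd_belowI2)
  fix n :: nat assume "n \<in> {2..}"
  then have n: "n \<ge> 2" by simp
  have "z_order k n \<in> {z_coloring n c | c. card (colors_used n c) \<le> k}"
    unfolding z_order_def
    using Min_in[OF finite_z_colorings[OF n] z_colorings_nonempty[OF n assms]] .
  then obtain c where "z_order k n = z_coloring n c" by blast
  then show "0 \<le> z_order k n" using z_coloring_in[OF n, of c] by auto
qed

end

theory Submission
  imports Defs
begin

text \<open>
  Write \<open>A s\<close> for the set of vertices incident with color \<open>s\<close>, and let \<open>q\<close> be the ceiling in the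
  theorem, so that \<open>k \<le> q (q + 1)\<close>. Any two vertices lie together in some \<open>A s\<close>, since the
  edge between them has a color. Suppose that every \<open>A s\<close> has fewer than \<open>n / q\<close> elements. The sets
  \<open>A s\<close> that contain a fixed vertex cover all \<open>n\<close> vertices, so there are at least \<open>q + 1\<close> of them.
  Counting the pairs \<open>(v, s)\<close> with \<open>v \<in> A s\<close> by vertices therefore gives at least \<open>n (q + 1)\<close>,
  whereas counting them by colors gives fewer than \<open>k n / q \<le> n (q + 1)\<close>. This contradiction is
  \<open>large_member_of_pair_cover\<close>.

  In terms of the intersecting hypergraph that has the colors as points and, for each vertex, the
  set of colors at it as an edge, the fractional covering number is at most \<open>q\<close>: either some
  edge with at most \<open>q\<close> points is a cover, or giving weight \<open>1 / (q + 1)\<close> to every point is a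
  fractional cover.
\<close>

lemma large_member_of_pair_cover:
  fixes A :: "'s \<Rightarrow> 'v set"
  assumes "finite V" "V \<noteq> {}" "finite S" "card S \<le> q * (q + 1)"
    and sub: "\<And>s. s \<in> S \<Longrightarrow> A s \<subseteq> V"
    and pair: "\<And>v w. v \<in> V \<Longrightarrow> w \<in> V \<Longrightarrow> \<exists>s\<in>S. v \<in> A s \<and> w \<in> A s"
  shows "\<exists>s\<in>S. card V \<le> q * card (A s)"
proof (rule ccontr)
  assume "\<not> ?thesis"
  then have small: "q * card (A s) < card V" if "s \<in> S" for s
    using that by (meson not_le)
  \<comment> \<open>This is used twice: for the members through a fixed point, and for the whole family.\<close>
  have sum_small: "q * (\<Sum>s\<in>T. card (A s)) < card T * card V" if "T \<subseteq> S" "T \<noteq> {}" for T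
  proof -
    have "finite T" using that assms(3) finite_subset by blast
    then have "(\<Sum>s\<in>T. q * card (A s)) < (\<Sum>s\<in>T. card V)"
      using that small by (intro sum_strict_mono) auto
    then show ?thesis by (simp add: sum_distrib_left)
  qed
  have many: "q + 1 \<le> card {s \<in> S. v \<in> A s}" if v: "v \<in> V" for v
  proof -
    let ?T = "{s \<in> S. v \<in> A s}"
    have ne: "?T \<noteq> {}" using pair[OF v v] by blast
    have cover: "V \<subseteq> (\<Union>s\<in>?T. A s)" using pair[OF v] by blast
    have finA: "finite (\<Union>s\<in>?T. A s)"
      using assms(3) sub finite_subset[OF _ assms(1)] by auto
    have "card V \<le> card (\<Union>s\<in>?T. A s)"
      using card_mono[OF finA cover] .
    also have "\<dots> \<le> (\<Sum>s\<in>?T. card (A s))"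
      using assms(3) by (intro card_UN_le) auto
    finally have "q * card V \<le> q * (\<Sum>s\<in>?T. card (A s))" by simp
    also have "\<dots> < card ?T * card V" using ne by (intro sum_small) auto
    finally show ?thesis by simp
  qed
  have "S \<noteq> {}" using assms(2) pair by blast
  have "(\<Sum>v\<in>V. card {s \<in> S. v \<in> A s}) = (\<Sum>s\<in>S. card {v \<in> V. v \<in> A s})"
    using sum.swap_restrict[OF assms(1,3), of "\<lambda>_ _. 1::nat" "\<lambda>v s. v \<in> A s"] by simp
  also have "\<dots> = (\<Sum>s\<in>S. card (A s))"
    using sub by (intro sum.cong refl arg_cong[where f = card]) blast
  finally have count: "(\<Sum>v\<in>V. card {s \<in> S. v \<in> A s}) = (\<Sum>s\<in>S. card (A s))" .
  have "(\<Sum>v\<in>V. q + 1) \<le> (\<Sum>v\<in>V. card {s \<in> S. v \<in> A s})"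
    using many by (intro sum_mono)
  then have "card V * (q + 1) \<le> (\<Sum>s\<in>S. card (A s))"
    unfolding count by simp
  then have "q * (card V * (q + 1)) \<le> q * (\<Sum>s\<in>S. card (A s))"
    by (rule mult_le_mono2)
  also have "\<dots> < card S * card V" using sum_small[of S] \<open>S \<noteq> {}\<close> by simp
  also have "\<dots> \<le> q * (q + 1) * card V" using assms(4) by (rule mult_le_mono1)
  finally show False by (simp add: algebra_simps)
qed

lemma z_coloring_lower_bound:
  assumes n: "n \<ge> 2" and q: "q \<ge> 1" and "card (colors_used n c) \<le> q * (q + 1)"
  shows "1 / real q \<le> z_coloring n c"
proof -
  define A where "A s = {v \<in> {..<n}. \<exists>e \<in> K_edges n. v \<in> e \<and> c e = s}" for s
  have edge: "\<exists>s \<in> colors_used n c. v \<in> A s \<and> w \<in> A s"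
    if "v < n" "w < n" "v \<noteq> w" for v w
  proof -
    have "{v, w} \<in> K_edges n" using that by (auto simp: K_edges_def)
    then show ?thesis
      using that by (intro bexI[of _ "c {v, w}"]) (auto simp: A_def colors_used_def)
  qed
  have "\<exists>s \<in> colors_used n c. card {..<n} \<le> q * card (A s)"
  proof (rule large_member_of_pair_cover)
    fix v w assume vw: "v \<in> {..<n}" "w \<in> {..<n}"
    show "\<exists>s \<in> colors_used n c. v \<in> A s \<and> w \<in> A s"
    proof (cases "v = w")
      case True
      \<comment> \<open>As \<open>n \<ge> 2\<close>, one of the vertices 0 and 1 differs from \<open>v\<close>, so \<open>v\<close> is on some edge.\<close>
      have "(if v = 0 then 1 else 0) < n" "v \<noteq> (if v = 0 then 1 else 0)" using n by auto
      then show ?thesis using edge vw True by blast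
    next
      case False
      then show ?thesis using edge vw by auto
    qed
  qed (use assms in \<open>auto simp: finite_colors_used A_def lessThan_empty_iff\<close>)
  then obtain s where s: "s \<in> colors_used n c" "n \<le> q * card (A s)" by auto
  have "real n \<le> real q * real (card (A s))"
    using s(2) by (metis of_nat_le_iff of_nat_mult)
  then have "1 / real q \<le> z_color n c s"
    using n q unfolding z_color_def A_def[symmetric] by (simp add: field_simps)
  also have "\<dots> \<le> z_coloring n c"
    unfolding z_coloring_def using s(1) by (intro Max_ge) (simp_all add: finite_colors_used)
  finally show ?thesis .
qed

lemma z_inf_lower_bound:
  assumes "k \<ge> 1" "k \<le> q * (q + 1)"
  shows "1 / real q \<le> z_inf k"
  unfolding z_inf_def
proof (rule cINF_greatest)
  fix n :: nat assume "n \<in> {2..}"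
  then have n: "n \<ge> 2" by simp
  have q: "q \<ge> 1" using assms by (cases q) auto
  have "z_order k n \<in> {z_coloring n c | c. card (colors_used n c) \<le> k}"
    unfolding z_order_def
    using Min_in[OF finite_z_colorings[OF n] z_colorings_nonempty[OF n assms(1)]] .
  then obtain c where "z_order k n = z_coloring n c" "card (colors_used n c) \<le> k" by blast
  then show "1 / real q \<le> z_order k n"
    using z_coloring_lower_bound[OF n q, of c] assms(2) by simp
qed auto

text \<open>
  The expression \<open>sqrt (k + 1 / 4) - 1 / 2\<close> is the positive root of \<open>x (x + 1) = k\<close>; rounding it up
  gives a \<open>q\<close> with \<open>k \<le> q (q + 1)\<close>.
\<close>

theorem corollary2p3:
  fixes k :: nat
  assumes "k \<ge> 3"
  shows "z_inf k \<ge> 1 / real_of_int \<lceil>sqrt (real k + 1 / 4) - 1 / 2\<rceil>"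
proof -
  define x where "x = sqrt (real k + 1 / 4) - 1 / 2"
  define q where "q = nat \<lceil>x\<rceil>"
  have "sqrt (1 / 4) \<le> sqrt (real k + 1 / 4)" by (intro real_sqrt_le_mono) simp
  then have x0: "0 \<le> x" by (simp add: x_def real_sqrt_divide)
  have root: "x * (x + 1) = real k"
  proof -
    have "(x + 1 / 2)\<^sup>2 = real k + 1 / 4" by (simp add: x_def)
    then show ?thesis by (simp add: power2_eq_square algebra_simps)
  qed
  have q: "real q = real_of_int \<lceil>x\<rceil>" using x0 by (simp add: q_def)
  then have "x \<le> real q" by (simp add: le_of_int_ceiling)
  then have "real k \<le> real q * (real q + 1)"
    unfolding root[symmetric] using x0 by (intro mult_mono) auto
  then have "real k \<le> real (q * (q + 1))" by (simp add: algebra_simps)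
  then have "k \<le> q * (q + 1)" unfolding of_nat_le_iff .
  then have "1 / real q \<le> z_inf k" using assms by (intro z_inf_lower_bound) auto
  then show ?thesis unfolding q x_def .
qed

end
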